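(* Let $x\in\mathcal{X}_{\mathrm{free}}$. Then the clearance function $\mathrm{clr}$ is discontinuous at $x$ if and only if $x\in E$.
   Context: Setting. $\mathcal{X}\subseteq\mathbb{R}^n$ (state space) is a linear subspace with inner product $\langle\cdot,\cdot\rangle$ and norm $\|\cdot\|$; $B_r(x)=\{y\in\mathcal{X}:\|x-y\|<r\}$. $F:\mathcal{X}\rightrightarrows\mathcal{X}$ is a set-valued map (the admissible velocities $F(x)=\{f(x,u):u\in\mathcal{U}\}$ of a control system) satisfying: (SH1) each $F(x)$ is nonempty and convex, the graph $\{(x,v):v\in F(x)\}$ is closed in $\mathcal{X}^2$, and for each compact $K\subset\mathcal{X}$ there is $M>0$ with $\|v\|\le M$ whenever $x\in K$, $v\in F(x)$; (SH2) there are $\gamma,c>0$ with $\|v\|\le\gamma\|x\|+c$ for all $x\in\mathcal{X}$, $v\in F(x)$; (SH3) for each compact $K\subset\mathcal{X}$ there is $k>0$ with $F(x)\subseteq F(y)+k\|x-y\|\overline{B_1(0)}$ for all $x,y\in K$. The running cost $\psi:\mathcal{X}^2\to(0,\infty)$ is continuous. Obstacles and trajectories. $\mathcal{O}\subset\mathcal{X}$ is a closed set (obstacle), $\mathcal{X}_{\mathrm{free}}:=\mathcal{X}\setminus\mathcal{O}$. $\Pi(x,y)$ is the set of absolutely continuous $\pi:[0,T_\pi]\to\mathcal{X}$ (some $T_\pi\ge0$) with $\dot\pi(t)\in F(\pi(t))$ for a.e. $t$, $\pi(0)=x$, $\pi(T_\pi)=y$, and $\pi(t)\in\overline{\mathcal{X}_{\mathrm{free}}}$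 for all $t\in[0,T_\pi]$. The cost of $\pi$ is $c_\pi:=\int_0^{T_\pi}\psi(\pi(t),\dot\pi(t))\,dt$. Derived notions. $d_c(x,y):=\inf\{c_\pi:\pi\in\Pi(x,y)\}$ ($=\infty$ if $\Pi(x,y)=\emptyset$); clearance $\mathrm{clr}:\mathcal{X}\to[0,\infty]$, $\mathrm{clr}(x):=\inf_{y\in\mathcal{O}}d_c(x,y)$ (continuity is with respect to the usual topology of $[0,\infty]$). Waves. For $\rho>0$, $W_\rho:=\{x\in\mathcal{X}_{\mathrm{free}}:\mathrm{clr}(x)<\rho\}$. For $x\in\mathcal{X}_{\mathrm{free}}$, $\rho_{\min}(x):=\inf\{\rho>0:x\in\partial W_\rho\}$ and $\rho_{\max}(x):=\sup\{\rho>0:x\in\partial W_\rho\}$, with $\rho_{\min}(x)=\rho_{\max}(x)=\infty$ when $\mathrm{clr}(x)=\infty$. The wave envelope is $E:=\{x\in\mathcal{X}_{\mathrm{free}}:\rho_{\min}(x)<\rho_{\max}(x)\}$.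
   Formalization: The convention that ρ_min(x) = ρ_max(x) = ∞ when clr(x) = ∞ is applied only if x lies on no wave front ∂W_ρ; applied unconditionally, the claim fails, e.g. F(a,b)={(1,b)}, ψ=exp(-|a|), O={|b|≥1}, at the origin. *)

theory Defs
  imports "HOL-Analysis.Analysis"
begin

text \<open>
  The state space is a linear subspace \<open>X\<close> of a Euclidean space, with the inherited inner product.
  All topological notions are those of \<open>X\<close> (\<open>top_of_set X\<close>), which matters when \<open>X\<close> is a proper
  subspace: a boundary taken in the ambient space would be too large.
  Maps on \<open>X\<close> are total functions whose values outside \<open>X\<close> are irrelevant.
\<close>

subsection \<open>Standing hypotheses\<close>

definition SH1 :: "'a::euclidean_space set \<Rightarrow> ('a \<Rightarrow> 'a set) \<Rightarrow> bool" where
  "SH1 X F \<longleftrightarrow>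
     (\<forall>x\<in>X. F x \<noteq> {} \<and> convex (F x)) \<and>
     closedin (top_of_set (X \<times> X)) {(x, v). x \<in> X \<and> v \<in> F x} \<and>
     (\<forall>K. compact K \<and> K \<subseteq> X \<longrightarrow> (\<exists>M>0. \<forall>x\<in>K. \<forall>v\<in>F x. norm v \<le> M))"

definition SH2 :: "'a::euclidean_space set \<Rightarrow> ('a \<Rightarrow> 'a set) \<Rightarrow> bool" where
  "SH2 X F \<longleftrightarrow> (\<exists>\<gamma>>0. \<exists>c>0. \<forall>x\<in>X. \<forall>v\<in>F x. norm v \<le> \<gamma> * norm x + c)"

definition SH3 :: "'a::euclidean_space set \<Rightarrow> ('a \<Rightarrow> 'a set) \<Rightarrow> bool" where
  "SH3 X F \<longleftrightarrow>
     (\<forall>K. compact K \<and> K \<subseteq> X \<longrightarrow>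
        (\<exists>k>0. \<forall>x\<in>K. \<forall>y\<in>K.
           F x \<subseteq> {w + (k * norm (x - y)) *\<^sub>R b | w b. w \<in> F y \<and> b \<in> X \<and> norm b \<le> 1}))"

subsection \<open>Trajectories and clearance\<close>

text \<open>
  Absolute continuity of a curve on \<open>{a..b}\<close>; a pair \<open>(s, t)\<close> in \<open>D\<close> stands for the interval from
  \<open>s\<close> to \<open>t\<close>. (\<open>absolutely_continuous\<close> in \<open>HOL-Analysis\<close> is the notion for measures.)
\<close>

definition abs_cont_curve :: "real \<Rightarrow> real \<Rightarrow> (real \<Rightarrow> 'a::real_normed_vector) \<Rightarrow> bool" where
  "abs_cont_curve a b f \<longleftrightarrow>
     (\<forall>\<epsilon>>0. \<exists>\<delta>>0. \<forall>D.
        finite D \<and>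
        (\<forall>(s, t)\<in>D. a \<le> s \<and> s < t \<and> t \<le> b) \<and>
        pairwise (\<lambda>p q. {fst p<..<snd p} \<inter> {fst q<..<snd q} = {}) D \<and>
        (\<Sum>(s, t)\<in>D. t - s) < \<delta>
        \<longrightarrow> (\<Sum>(s, t)\<in>D. norm (f t - f s)) < \<epsilon>)"

definition free_space :: "'a::euclidean_space set \<Rightarrow> 'a set \<Rightarrow> 'a set" where
  "free_space X Obs = X - Obs"

text \<open>
  A trajectory is a pair \<open>(T, p)\<close>; only the values of \<open>p\<close> on \<open>{0..T}\<close> matter, and derivatives
  are taken within \<open>{0..T}\<close>.
\<close>

definition trajectories ::
  "'a::euclidean_space set \<Rightarrow> ('a \<Rightarrow> 'a set) \<Rightarrow> 'a set \<Rightarrow> 'a \<Rightarrow> 'a \<Rightarrow> (real \<times> (real \<Rightarrow> 'a)) set"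
where
  "trajectories X F Obs x y =
     {(T, p). 0 \<le> T \<and> abs_cont_curve 0 T p \<and>
        (AE t in lebesgue. t \<in> {0..T} \<longrightarrow>
           (\<exists>v\<in>F (p t). (p has_vector_derivative v) (at t within {0..T}))) \<and>
        p 0 = x \<and> p T = y \<and>
        (\<forall>t\<in>{0..T}. p t \<in> top_of_set X closure_of free_space X Obs)}"

text \<open>
  The running cost is positive, so the cost integral may be taken in \<open>[0, \<infinity>]\<close>;
  \<open>vector_derivative\<close> is the derivative almost everywhere on a trajectory.
\<close>

definition traj_cost ::
  "('a \<times> 'a \<Rightarrow> real) \<Rightarrow> real \<times> (real \<Rightarrow> 'a::euclidean_space) \<Rightarrow> ennreal"
where
  "traj_cost \<psi> = (\<lambda>(T, p).
     \<integral>\<^sup>+t\<in>{0..T}. ennreal (\<psi> (p t, vector_derivative p (at t within {0..T}))) \<partial>lebesgue)"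

definition cost_dist ::
  "'a::euclidean_space set \<Rightarrow> ('a \<Rightarrow> 'a set) \<Rightarrow> ('a \<times> 'a \<Rightarrow> real) \<Rightarrow> 'a set \<Rightarrow> 'a \<Rightarrow> 'a \<Rightarrow> ennreal"
where
  "cost_dist X F \<psi> Obs x y = (INF \<pi>\<in>trajectories X F Obs x y. traj_cost \<psi> \<pi>)"

definition clr ::
  "'a::euclidean_space set \<Rightarrow> ('a \<Rightarrow> 'a set) \<Rightarrow> ('a \<times> 'a \<Rightarrow> real) \<Rightarrow> 'a set \<Rightarrow> 'a \<Rightarrow> ennreal"
where
  "clr X F \<psi> Obs x = (INF y\<in>Obs. cost_dist X F \<psi> Obs x y)"

subsection \<open>Waves\<close>

definition wave ::
  "'a::euclidean_space set \<Rightarrow> ('a \<Rightarrow> 'a set) \<Rightarrow> ('a \<times> 'a \<Rightarrow> real) \<Rightarrow> 'a set \<Rightarrow> real \<Rightarrow> 'a set"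
where
  "wave X F \<psi> Obs \<rho> = {x \<in> free_space X Obs. clr X F \<psi> Obs x < ennreal \<rho>}"

text \<open>The levels \<open>\<rho> > 0\<close> at which \<open>x\<close> lies on the wave front, as elements of \<open>[0, \<infinity>]\<close>.\<close>

definition front_levels ::
  "'a::euclidean_space set \<Rightarrow> ('a \<Rightarrow> 'a set) \<Rightarrow> ('a \<times> 'a \<Rightarrow> real) \<Rightarrow> 'a set \<Rightarrow> 'a \<Rightarrow> ennreal set"
where
  "front_levels X F \<psi> Obs x =
     ennreal ` {\<rho>. 0 < \<rho> \<and> x \<in> top_of_set X frontier_of wave X F \<psi> Obs \<rho>}"

text \<open>
  The convention that both values are \<open>\<infinity>\<close> where \<open>clr\<close> is infinite is read as a value for the
  infimum and supremum of the empty set of levels. It does not replace the infimum and supremum of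
  a nonempty set of levels, which can occur where \<open>clr\<close> is infinite: clearance need not be lower
  semicontinuous, because trajectories of bounded cost may run off to infinity. For instance, in
  the plane take \<open>F (a, b) = {(1, b)}\<close>, obstacle \<open>{(a, b). \<bar>b\<bar> \<ge> 1}\<close> and running cost
  \<open>exp (- \<bar>a\<bar>)\<close> at state \<open>(a, b)\<close>. Then \<open>clr (0, 0) = \<infinity>\<close>, whereas \<open>clr (0, b) = 1 - \<bar>b\<bar>\<close> for
  \<open>0 < \<bar>b\<bar> < 1\<close>. So \<open>clr\<close> is discontinuous at the origin, the levels there are exactly the
  \<open>\<rho> \<ge> 1\<close>, and the origin belongs to the wave envelope only if they are not overridden.
\<close>

definition rho_min ::
  "'a::euclidean_space set \<Rightarrow> ('a \<Rightarrow> 'a set) \<Rightarrow> ('a \<times> 'a \<Rightarrow> real) \<Rightarrow> 'a set \<Rightarrow> 'a \<Rightarrow> ennreal"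
where
  "rho_min X F \<psi> Obs x =
     (if clr X F \<psi> Obs x = \<infinity> \<and> front_levels X F \<psi> Obs x = {} then \<infinity>
      else Inf (front_levels X F \<psi> Obs x))"

definition rho_max ::
  "'a::euclidean_space set \<Rightarrow> ('a \<Rightarrow> 'a set) \<Rightarrow> ('a \<times> 'a \<Rightarrow> real) \<Rightarrow> 'a set \<Rightarrow> 'a \<Rightarrow> ennreal"
where
  "rho_max X F \<psi> Obs x =
     (if clr X F \<psi> Obs x = \<infinity> \<and> front_levels X F \<psi> Obs x = {} then \<infinity>
      else Sup (front_levels X F \<psi> Obs x))"

definition wave_envelope ::
  "'a::euclidean_space set \<Rightarrow> ('a \<Rightarrow> 'a set) \<Rightarrow> ('a \<times> 'a \<Rightarrow> real) \<Rightarrow> 'a set \<Rightarrow> 'a set"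
where
  "wave_envelope X F \<psi> Obs =
     {x \<in> free_space X Obs. rho_min X F \<psi> Obs x < rho_max X F \<psi> Obs x}"

end

theory Submission
  imports Defs
begin

text \<open>
  The statement is about an arbitrary function \<open>f\<close> in place of the clearance. A point lies on the
  frontier of the sublevel set \<open>{f < \<rho>}\<close> exactly if \<open>f < \<rho>\<close> and \<open>f \<ge> \<rho>\<close> both hold at points
  arbitrarily close to it. If \<open>f\<close> is continuous at \<open>x\<close>, this forces \<open>\<rho> = f x\<close>, so there is at most
  one level. If it is not, then every \<open>\<rho>\<close> strictly between the lower and the upper limit of \<open>f\<close>
  at \<open>x\<close> is a level.
\<close>

text \<open>\<open>inf (nhds x) (principal X)\<close> is the neighbourhood filter of
  \<open>x\<close> in the subspace, with \<open>x\<close> itself kept, unlike in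
  \<open>at x within X\<close>. In it, closure reads as "frequently" and interior as
  "eventually".\<close>

lemma in_frontier_of_top_of_set_iff_frequently:
  assumes "x \<in> X"
  shows "x \<in> top_of_set X frontier_of S \<longleftrightarrow>
    (\<exists>\<^sub>F y in inf (nhds x) (principal X). y \<in> S) \<and>
    (\<exists>\<^sub>F y in inf (nhds x) (principal X). y \<notin> S)"
proof -
  have ev: "eventually P (inf (nhds x) (principal X)) \<longleftrightarrow>
      (\<exists>T. openin (top_of_set X) T \<and> x \<in> T \<and> (\<forall>y\<in>T. P y))" for P
    unfolding eventually_inf_principal eventually_nhds openin_open
    using assms by blast
  have "x \<in> top_of_set X closure_of S \<longleftrightarrow> (\<exists>\<^sub>F y in inf (nhds x) (principal X). y \<in> S)"
    unfolding frequently_def ev in_closure_of using assms by auto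
  moreover have "x \<in> top_of_set X interior_of S \<longleftrightarrow> (\<forall>\<^sub>F y in inf (nhds x) (principal X). y \<in> S)"
    unfolding ev interior_of_def by blast
  ultimately show ?thesis
    by (simp add: frontier_of_def not_eventually)
qed

text \<open>Since \<open>U\<close> is a neighbourhood of \<open>x\<close>, the filter does not see
  the restriction to \<open>U\<close>.\<close>

lemma in_frontier_of_sublevel_iff:
  fixes f :: "'a::topological_space \<Rightarrow> 'b::linorder"
  assumes U: "openin (top_of_set X) U" "x \<in> U"
  shows "x \<in> top_of_set X frontier_of {y \<in> U. f y < r} \<longleftrightarrow>
    (\<exists>\<^sub>F y in inf (nhds x) (principal X). f y < r) \<and>
    (\<exists>\<^sub>F y in inf (nhds x) (principal X). r \<le> f y)"
proof -
  have "x \<in> X"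
    using openin_subset[OF U(1)] U(2) by auto
  have "\<forall>\<^sub>F y in inf (nhds x) (principal X). y \<in> U"
    using U unfolding eventually_inf_principal eventually_nhds openin_open by blast
  then have "(\<exists>\<^sub>F y in inf (nhds x) (principal X). y \<in> {y \<in> U. f y < r}) \<longleftrightarrow>
        (\<exists>\<^sub>F y in inf (nhds x) (principal X). f y < r)"
    and "(\<exists>\<^sub>F y in inf (nhds x) (principal X). y \<notin> {y \<in> U. f y < r}) \<longleftrightarrow>
        (\<exists>\<^sub>F y in inf (nhds x) (principal X). r \<le> f y)"
    by (auto intro!: frequently_cong elim: eventually_mono)
  then show ?thesis
    using in_frontier_of_top_of_set_iff_frequently[OF \<open>x \<in> X\<close>] by blast
qed

lemma sublevel_frontier_if_continuous:
  fixes f :: "'a::t2_space \<Rightarrow> 'b::linorder_topology"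
  assumes "openin (top_of_set X) U" "x \<in> U"
    and "continuous (at x within X) f"
    and "x \<in> top_of_set X frontier_of {y \<in> U. f y < r}"
  shows "f x = r"
proof (rule ccontr)
  assume "f x \<noteq> r"
  \<comment> \<open>Adding the point \<open>x\<close> back to the punctured filter is harmless, as
    the limit is the value at \<open>x\<close>.\<close>
  have lim: "(f \<longlongrightarrow> f x) (inf (nhds x) (principal X))"
    using assms(3) by (simp add: continuous_within tendsto_at_iff_tendsto_nhds_within)
  have "(\<forall>\<^sub>F y in inf (nhds x) (principal X). r < f y) \<or>
      (\<forall>\<^sub>F y in inf (nhds x) (principal X). f y < r)"
    using \<open>f x \<noteq> r\<close> order_tendstoD[OF lim] by (meson linorder_neqE)
  then show False
    using assms(4) unfolding in_frontier_of_sublevel_iff[OF assms(1,2)]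
    by (auto simp: frequently_def not_less not_le dest: eventually_mono[OF _ less_imp_le])
qed

lemma sublevel_frontier_interval_if_not_continuous:
  fixes f :: "'a::t2_space \<Rightarrow> 'b::linorder_topology"
  assumes U: "openin (top_of_set X) U" "x \<in> U"
    and "\<not> continuous (at x within X) f"
  obtains a b where "a < b"
    and "\<And>r. \<lbrakk>a < r; r < b\<rbrakk> \<Longrightarrow> x \<in> top_of_set X frontier_of {y \<in> U. f y < r}"
proof -
  let ?N = "inf (nhds x) (principal X)"
  \<comment> \<open>Every neighbourhood contains \<open>x\<close>, so \<open>x\<close> itself
    witnesses one of the two frequencies below.\<close>
  have at_x: "\<exists>\<^sub>F y in ?N. P y" if "P x" for P
    using that openin_subset[OF U(1)] U(2)
    by (auto simp: frequently_def eventually_inf_principal dest: eventually_nhds_x_imp_x)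
  have "\<not> (f \<longlongrightarrow> f x) ?N"
    using assms(3) by (simp add: continuous_within tendsto_at_iff_tendsto_nhds_within)
  \<comment> \<open>In an order topology, convergence fails through a bound on one side of
    \<open>f x\<close>. The levels found lie between that bound and \<open>f x\<close>.\<close>
  then consider a where "a < f x" "\<exists>\<^sub>F y in ?N. f y \<le> a" | b where "f x < b" "\<exists>\<^sub>F y in ?N. b \<le> f y"
    unfolding order_tendsto_iff by (auto simp: not_eventually not_less)
  then show thesis
  proof cases
    case 1
    have "x \<in> top_of_set X frontier_of {y \<in> U. f y < r}" if "a < r" "r < f x" for r
      unfolding in_frontier_of_sublevel_iff[OF U]
      using that by (auto intro!: at_x[of "\<lambda>y. r \<le> f y"] intro: frequently_elim1[OF 1(2)])
    then show thesis
      using that[OF 1(1)] by blast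
  next
    case 2
    have "x \<in> top_of_set X frontier_of {y \<in> U. f y < r}" if "f x < r" "r < b" for r
      unfolding in_frontier_of_sublevel_iff[OF U]
      using that by (auto intro!: at_x[of "\<lambda>y. f y < r"] intro: frequently_elim1[OF 2(2)])
    then show thesis
      using that[OF 2(1)] by blast
  qed
qed

text \<open>Wave levels are positive finite reals, while the gap at a discontinuity may start at 0
  or end at \<infinity>. Two of them are needed to separate infimum from supremum.\<close>

lemma ennreal_two_reals_between:
  fixes a b :: ennreal
  assumes "a < b"
  obtains r s :: real where "0 < r" "r < s" "a < ennreal r" "ennreal s < b"
proof -
  obtain c where c: "a < c" "c < b"
    using dense[OF assms] by blast
  obtain d where d: "c < d" "d < b"
    using dense[OF c(2)] by blast
  \<comment> \<open>Lying above \<open>a\<close> makes \<open>c\<close> positive; lying below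
    \<open>b\<close> makes \<open>d\<close> finite.\<close>
  have "0 < c" "c < top" "d < top"
    using c d by (auto intro: le_less_trans less_le_trans)
  then obtain r s where "c = ennreal r" "0 < r" "d = ennreal s" "0 \<le> s"
    by (metis ennreal_cases ennreal_less_zero_iff less_irrefl)
  then show thesis
    using that c d by (auto simp: ennreal_less_iff)
qed

theorem theorem5p3:
  fixes X :: "'a::euclidean_space set"
    and F :: "'a \<Rightarrow> 'a set"
    and \<psi> :: "'a \<times> 'a \<Rightarrow> real"
    and Obs :: "'a set"
    and x :: 'a
  assumes "subspace X"
    and "\<And>y. y \<in> X \<Longrightarrow> F y \<subseteq> X"
    and "SH1 X F"
    and "SH2 X F"
    and "SH3 X F"
    and "continuous_on (X \<times> X) \<psi>"
    and "\<And>y v. y \<in> X \<Longrightarrow> v \<in> X \<Longrightarrow> 0 < \<psi> (y, v)"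
    and "closedin (top_of_set X) Obs"
    and "x \<in> free_space X Obs"
  shows "\<not> continuous (at x within X) (clr X F \<psi> Obs) \<longleftrightarrow> x \<in> wave_envelope X F \<psi> Obs"
proof -
  let ?f = "clr X F \<psi> Obs" and ?L = "front_levels X F \<psi> Obs x"
  have U: "openin (top_of_set X) (free_space X Obs)"
    unfolding free_space_def using assms(8) by (simp add: openin_diff)
  have L: "?L = ennreal ` {r. 0 < r \<and>
      x \<in> top_of_set X frontier_of {y \<in> free_space X Obs. ?f y < ennreal r}}"
    unfolding front_levels_def wave_def ..
  show ?thesis
  proof
    assume "\<not> continuous (at x within X) ?f"
    then obtain a b where "a < b"
      and ab: "\<And>r. \<lbrakk>a < r; r < b\<rbrakk> \<Longrightarrow>
        x \<in> top_of_set X frontier_of {y \<in> free_space X Obs. ?f y < r}"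
      using sublevel_frontier_interval_if_not_continuous[OF U assms(9)] by blast
    obtain r s where rs: "0 < r" "r < s" "a < ennreal r" "ennreal s < b"
      using ennreal_two_reals_between[OF \<open>a < b\<close>] .
    have "ennreal r < ennreal s"
      using rs by (simp add: ennreal_less_iff)
    then have "ennreal r \<in> ?L" "ennreal s \<in> ?L"
      unfolding L using rs by (auto intro!: imageI ab)
    \<comment> \<open>Nonemptiness excludes the conventional value \<infinity> in
      \<open>rho_min\<close> and \<open>rho_max\<close>.\<close>
    then have "Inf ?L < Sup ?L" "?L \<noteq> {}"
      using \<open>ennreal r < ennreal s\<close> Inf_lower[of "ennreal r" ?L] Sup_upper[of "ennreal s" ?L]
      by auto
    then show "x \<in> wave_envelope X F \<psi> Obs"
      using assms(9) by (simp add: wave_envelope_def rho_min_def rho_max_def)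
  next
    assume "x \<in> wave_envelope X F \<psi> Obs"
    \<comment> \<open>Under the convention both values are \<infinity>, so the strict inequality
      rules that case out.\<close>
    then have "Inf ?L < Sup ?L"
      by (auto simp: wave_envelope_def rho_min_def rho_max_def split: if_splits)
    show "\<not> continuous (at x within X) ?f"
    proof
      assume "continuous (at x within X) ?f"
      then have "?L \<subseteq> {?f x}"
        unfolding L using sublevel_frontier_if_continuous[OF U assms(9)] by fastforce
      \<comment> \<open>For no level the infimum is \<infinity> and the supremum 0; for a single
        level they agree.\<close>
      then have "?L = {} \<or> ?L = {?f x}"
        by blast
      then show False
        using \<open>Inf ?L < Sup ?L\<close> by auto
    qed
  qed
qed

end
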